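(* Let $r,d\ge 1$ be integers. If $n_1,n_2\ge r$ are integers with $n_1\equiv n_2\pmod d$, then $$(-1)^{n_1}C_r(n_1)\equiv(-1)^{n_2}C_r(n_2)\pmod d.$$ In particular, the sequence $(C_r(n)\bmod d)_{n\ge r}$ is periodic of period $d$ if $d$ is even, and of period $2d$ if $d$ is odd.
   Context: For integers $n,r\ge 0$, the $r$-derangement number $D_r(n)$ is the number of permutations of $\{1,\dots,n+r\}$ that have no fixed points and in whose cycle decomposition the elements $1,\dots,r$ lie in pairwise distinct cycles. For $r\ge 1$ and $n\ge r$ define $$C_r(n)=\frac{(n-r)!}{n!}D_r(n)=\sum_{j=r}^{n}\binom{j}{r}(n-r)_{j-r}(-1)^{n-j},$$ where $(x)_m=x(x-1)\cdots(x-m+1)$ for $m\ge 1$ and $(x)_0=1$; thus $C_r(n)$ is an integer. A sequence $(a_n)_{n\ge n_0}$ is periodic of period $T$ if $a_{n+T}=a_n$ for all $n\ge n_0$; minimality of $T$ is not asserted. *)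

theory Defs
  imports Complex_Main "HOL-Combinatorics.Orbits" "HOL-Combinatorics.Permutations" "HOL-Number_Theory.Cong"
begin

text \<open>
  For a permutation \<open>p\<close> of a finite set, \<open>orbit p i\<close> is the set of elements of the cycle of \<open>p\<close>
  that contains \<open>i\<close>, so injectivity of \<open>orbit p\<close> on \<open>{1..r}\<close> says that \<open>1, \<dots>, r\<close> lie in
  pairwise distinct cycles.
\<close>

definition r_derangements :: "nat \<Rightarrow> nat \<Rightarrow> (nat \<Rightarrow> nat) set" where
  "r_derangements r n =
     {p. p permutes {1..n + r} \<and> (\<forall>i\<in>{1..n + r}. p i \<noteq> i) \<and> inj_on (orbit p) {1..r}}"

definition r_derangement_number :: "nat \<Rightarrow> nat \<Rightarrow> nat" where
  "r_derangement_number r n = card (r_derangements r n)"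

text \<open>
  Meant for \<open>1 \<le> r \<le> n\<close>. The value is an integer there, but this depends on a theorem about
  \<open>r_derangement_number\<close>, so the quotient is taken in the rationals.
\<close>

definition C :: "nat \<Rightarrow> nat \<Rightarrow> rat" where
  "C r n = fact (n - r) / fact n * of_nat (r_derangement_number r n)"

definition periodic_from :: "nat \<Rightarrow> nat \<Rightarrow> (nat \<Rightarrow> 'a) \<Rightarrow> bool" where
  "periodic_from n0 T a \<longleftrightarrow> (\<forall>n\<ge>n0. a (n + T) = a n)"

end

theory Submission
  imports Defs
begin

text \<open>
  Let \<open>R \<subseteq> V\<close>. Inserting the elements of \<open>V - R\<close> one at a time into the cycles of a permutation shows
  that \<open>\<bar>V\<bar>! / \<bar>R\<bar>!\<close> permutations of \<open>V\<close> have the elements of \<open>R\<close> in pairwise distinct cycles.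
  Fixed points are then forbidden one at a time: those permutations that do fix \<open>t\<close> are the permutations of
  \<open>V - {t}\<close> with marked set \<open>R - {t}\<close>. For \<open>t \<in> R\<close> this is Pascal's rule, and after all of \<open>R\<close> it
  leaves \<open>m! (m choose r)\<close> with \<open>m = \<bar>V - R\<bar>\<close>; for \<open>t \<notin> R\<close> it produces an alternating sum over \<open>k\<close>
  of the terms \<open>(m - k)! (m - k choose r)\<close>. After division by \<open>n! / (n - r)!\<close>, the number \<open>(-1)^n C r n\<close>
  becomes the value at \<open>n\<close> of a polynomial with integer coefficients, and such values respect congruences.
\<close>

section \<open>Cycles and the insertion of an unmarked element\<close>

text \<open>\<open>V\<close>, \<open>R\<close> and \<open>T\<close> vary independently because the
  recursion deletes fixed points from \<open>V\<close> and \<open>R\<close> while \<open>T\<close>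
  grows; r-derangements have \<open>V = {1..n + r}\<close>, \<open>R = {1..r}\<close> and
  \<open>T = V\<close>.\<close>

definition separating :: "'a set \<Rightarrow> 'a set \<Rightarrow> 'a set \<Rightarrow> ('a \<Rightarrow> 'a) set" where
  "separating V R T = {p. p permutes V \<and> inj_on (orbit p) R \<and> (\<forall>i\<in>T. p i \<noteq> i)}"

lemma finite_separating: "finite V \<Longrightarrow> finite (separating V R T)"
  unfolding separating_def by (rule finite_subset[OF _ finite_permutations[of V]]) auto

lemma orbit_eq_iff_mem:
  assumes "finite V" "p permutes V"
  shows "orbit p i = orbit p j \<longleftrightarrow> j \<in> orbit p i"
proof
  \<comment> \<open>\<open>orbit p j\<close> starts at \<open>p j\<close>; finite support makes it
    return to \<open>j\<close>.\<close>
  have "permutation p"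
    using assms permutation_permutes by blast
  then show "j \<in> orbit p i" if "orbit p i = orbit p j"
    using that permutation_self_in_orbit by metis
  show "orbit p i = orbit p j" if "j \<in> orbit p i"
    using orbit_cyclic_eq3[OF cyclic_on_orbit[OF assms(2,1)] that] by simp
qed

lemma inj_on_orbit_iff:
  assumes "finite V" "p permutes V"
  shows "inj_on (orbit p) R \<longleftrightarrow> (\<forall>i\<in>R. \<forall>j\<in>R. j \<in> orbit p i \<longrightarrow> i = j)"
  unfolding inj_on_def orbit_eq_iff_mem[OF assms] ..

text \<open>Composing with the transposition inserts \<open>a\<close> just before \<open>b\<close>
  in the cycle of \<open>b\<close>, so the cycles keep their traces on \<open>V\<close>.\<close>

lemma orbit_transpose_comp:
  assumes q: "q permutes V" and a: "a \<notin> V" and b: "b \<in> V" and i: "i \<in> V" and j: "j \<in> V"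
  shows "j \<in> orbit (transpose a b \<circ> q) i \<longleftrightarrow> j \<in> orbit q i"
proof -
  let ?p = "transpose a b \<circ> q"
  have qa: "q a = a"
    using q a by (simp add: permutes_not_in)
  have pa: "?p a = b"
    using qa by simp
  have p_eq: "?p x = (if q x = b then a else q x)" if "x \<noteq> a" for x
  proof -
    have "q x \<noteq> a"
      using that qa permutes_inj[OF q] by (metis injD)
    then show ?thesis by (auto simp: transpose_def)
  qed
  \<comment> \<open>One step of \<open>q\<close> is one step of \<open>?p\<close>, or two when it
    arrives at \<open>b\<close> by way of \<open>a\<close>.\<close>
  have in_p: "q x \<in> orbit ?p i" if "x \<noteq> a" "?p x \<in> orbit ?p i" for x
  proof (cases "q x = b")
    case True
    then have "?p x = a" using p_eq[OF that(1)] by simp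
    then show ?thesis using orbit.step[OF that(2)] pa True by metis
  next
    case False
    then show ?thesis using p_eq[OF that(1)] that(2) by simp
  qed
  have *: "x \<in> orbit q i \<Longrightarrow> x \<in> V" for x
    by (induction rule: orbit.induct) (use i q in \<open>auto simp: permutes_in_image\<close>)
  have "x \<in> orbit ?p i" if "x \<in> orbit q i" for x
    using that
  proof (induction rule: orbit.induct)
    case base
    show ?case using in_p[of i] orbit.base[of ?p i] i a by blast
  next
    case (step x)
    then show ?case using in_p[of x] orbit.step[of x ?p i] *[of x] a by blast
  qed
  \<comment> \<open>Reading the detour point \<open>a\<close> as its successor \<open>b\<close>
    gives an invariant that survives every step of \<open>?p\<close>.\<close>
  moreover have "(if x = a then b else x) \<in> orbit q i" if "x \<in> orbit ?p i" for x
    using that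
  proof (induction rule: orbit.induct)
    case base
    have "i \<noteq> a" using i a by auto
    then show ?case using p_eq[of i] orbit.base[of q i] qa a by (auto split: if_splits)
  next
    case (step x)
    show ?case
    proof (cases "x = a")
      case True
      then have "?p x = b" using pa by simp
      then show ?thesis using step.IH True a b by (auto simp del: o_apply)
    next
      case False
      then have "q x \<in> orbit q i" using step.IH orbit.step[of x q i] by simp
      then show ?thesis using p_eq[OF False] qa a by (auto split: if_splits)
    qed
  qed
  ultimately show ?thesis
    using j a by metis
qed

lemma permutes_insert_iff:
  "p permutes insert a V \<longleftrightarrow> (\<exists>b q. b \<in> insert a V \<and> q permutes V \<and> p = transpose a b \<circ> q)"
proof -
  have "p permutes insert a V \<longleftrightarrow> p \<in> {p. p permutes insert a V}" by simp
  then show ?thesis unfolding permutes_insert image_iff by auto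
qed

text \<open>The choice \<open>b = a\<close> makes \<open>a\<close> a cycle of its own, any other
  \<open>b\<close> inserts \<open>a\<close> before \<open>b\<close>. As \<open>a\<close> is not in
  \<open>R\<close>, neither changes which marked elements share a cycle.\<close>

lemma separating_insert_unmarked:
  assumes fin: "finite V" and R: "R \<subseteq> V" and a: "a \<notin> V"
  shows "separating (insert a V) R {} =
    (\<lambda>(b, q). transpose a b \<circ> q) ` (insert a V \<times> separating V R {})"
proof -
  have "inj_on (orbit (transpose a b \<circ> q)) R \<longleftrightarrow> inj_on (orbit q) R"
    if "q permutes V" "b \<in> insert a V" for b q
  proof (cases "b = a")
    case False
    then have b: "b \<in> V" using that by simp
    have p: "transpose a b \<circ> q permutes insert a V"
      using that b by (intro permutes_compose[OF permutes_subset[OF that(1)]] permutes_swap_id) auto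
    then show ?thesis
      using orbit_transpose_comp[OF that(1) a b] R
      unfolding inj_on_orbit_iff[OF fin that(1)] inj_on_orbit_iff[OF finite.insertI[OF fin] p]
      by (metis subsetD)
  qed (simp add: o_def)
  then have *: "p \<in> separating (insert a V) R {} \<longleftrightarrow>
      (\<exists>b q. b \<in> insert a V \<and> q \<in> separating V R {} \<and> p = transpose a b \<circ> q)" for p
    unfolding separating_def permutes_insert_iff by blast
  show ?thesis
    by (rule set_eqI, unfold *)
      (simp only: image_iff Bex_def split_paired_Ex mem_Sigma_iff case_prod_conv conj_assoc)
qed

text \<open>Since \<open>q\<close> fixes \<open>a\<close>, the composite sends \<open>a\<close> to
  \<open>b\<close>; this recovers \<open>b\<close>, and cancelling the transposition recovers
  \<open>q\<close>.\<close>

lemma inj_on_transpose_comp: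
  assumes "a \<notin> V"
  shows "inj_on (\<lambda>(b, q). transpose a b \<circ> q) (insert a V \<times> {q. q permutes V})"
proof (rule inj_onI, clarify)
  fix b q c q'
  assume q: "q permutes V" and q': "q' permutes V" and eq: "transpose a b \<circ> q = transpose a c \<circ> q'"
  have "b = (transpose a b \<circ> q) a"
    using permutes_not_in[OF q assms] by simp
  also have "\<dots> = c"
    unfolding eq using permutes_not_in[OF q' assms] by simp
  finally have "b = c" .
  moreover from this have "q = q'"
    using eq by (metis comp_assoc transpose_comp_involutory id_comp)
  ultimately show "b = c \<and> q = q'" by simp
qed

section \<open>Counting without forbidden fixed points\<close>

text \<open>Each \<open>x\<close> shares its cycle with \<open>p x\<close>, so marking every point
  forces \<open>p x = x\<close>.\<close>

lemma separating_self:
  assumes "finite R"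
  shows "separating R R {} = {id}"
proof -
  have "p = id" if p: "p permutes R" "inj_on (orbit p) R" for p
  proof
    fix x
    show "p x = id x"
    proof (cases "x \<in> R")
      case True
      then have "x = p x"
        using that inj_on_orbit_iff[OF assms p(1)] orbit.base[of p x] permutes_in_image[OF p(1)]
        by metis
      then show ?thesis by simp
    qed (use p in \<open>simp add: permutes_not_in\<close>)
  qed
  moreover have "inj_on (orbit id) R"
  proof -
    have "j \<in> orbit id i \<Longrightarrow> i = j" for i j :: 'a
      by (induction rule: orbit.induct) auto
    then show ?thesis
      unfolding inj_on_orbit_iff[OF assms permutes_id] by blast
  qed
  ultimately show ?thesis
    by (auto simp: separating_def permutes_id)
qed

text \<open>Each new unmarked element has \<open>Suc (card ?V)\<close> places: before any earlier
  element, or alone.\<close>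

lemma fact_card_separating:
  assumes "finite W" "finite R" "W \<inter> R = {}"
  shows "fact (card R) * card (separating (R \<union> W) R {}) = fact (card (R \<union> W))"
  using assms
proof (induction W)
  case empty
  then show ?case by (simp add: separating_self)
next
  case (insert a W)
  let ?V = "R \<union> W"
  have fin: "finite ?V" and a: "a \<notin> ?V" using insert by auto
  have "card (separating (insert a ?V) R {}) = card (insert a ?V \<times> separating ?V R {})"
    unfolding separating_insert_unmarked[OF fin Un_upper1 a]
    by (intro card_image inj_on_subset[OF inj_on_transpose_comp[OF a]]) (auto simp: separating_def)
  also have "\<dots> = Suc (card ?V) * card (separating ?V R {})"
    using fin a by (simp add: card_cartesian_product)
  finally have "fact (card R) * card (separating (insert a ?V) R {}) =
      Suc (card ?V) * (fact (card R) * card (separating ?V R {}))"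
    by (simp only: mult.left_commute)
  also have "fact (card R) * card (separating ?V R {}) = fact (card ?V)"
    using insert by simp
  finally have "fact (card R) * card (separating (insert a ?V) R {}) = Suc (card ?V) * fact (card ?V)" .
  then show ?case
    using fin a by simp
qed

section \<open>Forbidding fixed points one at a time\<close>

text \<open>A fixed \<open>t\<close> is alone in its cycle, so it never conflicts with another
  marked element and can be deleted from \<open>V\<close> and \<open>R\<close>, marked or
  not.\<close>

lemma separating_split_fixed:
  assumes fin: "finite V" and t: "t \<in> V" "t \<notin> T"
  shows "separating V R T = separating V R (insert t T) \<union> separating (V - {t}) (R - {t}) T"
    and "separating V R (insert t T) \<inter> separating (V - {t}) (R - {t}) T = {}"
proof -
  have perm: "p permutes V - {t} \<longleftrightarrow> p permutes V \<and> p t = t" for p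
    using permutes_subset[of p "V - {t}" V] permutes_not_in[of p "V - {t}" t]
      permutes_superset[of p V "V - {t}"] by auto
  have inj: "inj_on (orbit p) (R - {t}) \<longleftrightarrow> inj_on (orbit p) R" if p: "p permutes V" "p t = t" for p
  proof -
    have t1: "j \<in> orbit p t \<Longrightarrow> j = t" for j
      by (induction rule: orbit.induct) (use p in auto)
    then have "t \<in> orbit p i \<Longrightarrow> i = t" for i
      using orbit_eq_iff_mem[OF fin p(1)] by metis
    with t1 show ?thesis
      unfolding inj_on_orbit_iff[OF fin p(1)] by (metis Diff_iff singletonD singletonI)
  qed
  have "separating (V - {t}) (R - {t}) T = {p \<in> separating V R T. p t = t}"
    unfolding separating_def perm using inj by blast
  then show "separating V R T = separating V R (insert t T) \<union> separating (V - {t}) (R - {t}) T"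
    and "separating V R (insert t T) \<inter> separating (V - {t}) (R - {t}) T = {}"
    by (auto simp: separating_def)
qed

lemma card_separating_split:
  assumes "finite V" "t \<in> V" "t \<notin> T"
  shows "card (separating V R T) =
    card (separating V R (insert t T)) + card (separating (V - {t}) (R - {t}) T)"
  unfolding separating_split_fixed(1)[OF assms, of R]
  by (intro card_Un_disjoint separating_split_fixed(2) finite_separating) (use assms in auto)

lemma card_separating_marked:
  assumes "finite T" "finite V" "R \<subseteq> V" "T \<subseteq> R"
  shows "card (separating V R T) = fact (card (V - R)) * (card V - card T choose card R)"
  using assms
proof (induction T arbitrary: V R)
  case empty
  have fR: "finite R" using empty finite_subset by blast
  have c: "card (V - R) = card V - card R" "card R \<le> card V"
    using empty by (auto simp: card_Diff_subset fR card_mono)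
  have "fact (card R) * card (separating V R {}) = fact (card V)"
    using fact_card_separating[of "V - R" R] empty fR
    by (metis Diff_disjoint Int_commute Un_Diff_cancel finite_Diff sup.absorb2)
  also have "\<dots> = fact (card R) * (fact (card (V - R)) * (card V choose card R))"
    using binomial_fact_lemma[OF c(2)] c(1) by (simp add: mult_ac)
  finally show ?case by simp
next
  case (insert t T)
  let ?V = "V - {t}" and ?R = "R - {t}"
  have t: "t \<in> R" "t \<in> V" using insert.prems by auto
  have fR: "finite R" using insert.prems finite_subset by blast
  \<comment> \<open>Deleting a marked point leaves the unmarked set alone, so both terms carry the
    same factorial.\<close>
  have eq: "?V - ?R = V - R" using t by auto
  have cV: "card V = Suc (card ?V)" and cR: "card R = Suc (card ?R)"
    using t insert.prems(1) fR by (metis card_Suc_Diff1)+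
  have le: "card T \<le> card ?V"
    using insert.prems insert.hyps by (intro card_mono) auto
  have IH: "card (separating ?V ?R T) = fact (card (V - R)) * (card ?V - card T choose card ?R)"
    unfolding eq[symmetric] using insert.prems insert.hyps by (intro insert.IH) auto
  have "card (separating V R (insert t T)) + card (separating ?V ?R T) = card (separating V R T)"
    by (rule card_separating_split[OF insert.prems(1) t(2) insert.hyps(2), symmetric])
  also have "\<dots> = fact (card (V - R)) * (card V - card T choose card R)"
    using insert.prems by (intro insert.IH) auto
  \<comment> \<open>Pascal's rule; \<open>le\<close> keeps the natural subtraction from
    truncating.\<close>
  also have "card V - card T choose card R =
      (card ?V - card T choose card R) + (card ?V - card T choose card ?R)"
    unfolding cV cR using le by (simp add: Suc_diff_le)
  finally have "card (separating V R (insert t T)) = fact (card (V - R)) * (card ?V - card T choose card R)"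
    unfolding IH distrib_left by (rule add_right_imp_eq)
  moreover have "card ?V - card T = card V - card (insert t T)"
    using insert.hyps cV by simp
  ultimately show ?case by (rule back_subst[of "\<lambda>k. _ = _ * (k choose _)"])
qed

text \<open>With \<open>E\<close> the shift of \<open>g\<close>, the sums are values at 0 of
  \<open>(1 - E)^s g\<close>, and \<open>(1 - E)^(s + 1) = (1 - E)^s - (1 - E)^s E\<close>.\<close>

lemma alternating_binomial_Suc:
  fixes g :: "nat \<Rightarrow> 'a :: comm_ring_1"
  shows "(\<Sum>k\<le>Suc s. (- 1) ^ k * of_nat (Suc s choose k) * g k) =
    (\<Sum>k\<le>s. (- 1) ^ k * of_nat (s choose k) * g k) -
    (\<Sum>k\<le>s. (- 1) ^ k * of_nat (s choose k) * g (Suc k))"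
proof -
  have "(\<Sum>k\<le>Suc s. (- 1) ^ k * of_nat (Suc s choose k) * g k) =
      g 0 + (\<Sum>k\<le>s. (- 1) ^ Suc k * of_nat (s choose Suc k) * g (Suc k)) -
      (\<Sum>k\<le>s. (- 1) ^ k * of_nat (s choose k) * g (Suc k))"
    unfolding sum.atMost_Suc_shift
    by (simp add: algebra_simps sum.distrib sum_negf sum_subtractf)
  also have "g 0 + (\<Sum>k\<le>s. (- 1) ^ Suc k * of_nat (s choose Suc k) * g (Suc k)) =
      (\<Sum>k\<le>Suc s. (- 1) ^ k * of_nat (s choose k) * g k)"
    unfolding sum.atMost_Suc_shift by simp
  also have "\<dots> = (\<Sum>k\<le>s. (- 1) ^ k * of_nat (s choose k) * g k)"
    by (simp add: binomial_eq_0)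
  finally show ?thesis .
qed

text \<open>With all of \<open>R\<close> already forbidden as fixed points, each further unmarked
  point applies one more difference operator.\<close>

lemma card_separating_unmarked:
  assumes "finite T" "finite V" "R \<subseteq> V" "T \<subseteq> V - R"
  shows "int (card (separating V R (R \<union> T))) =
    (\<Sum>k\<le>card T. (- 1) ^ k * int (card T choose k) *
      (fact (card (V - R) - k) * int (card (V - R) - k choose card R)))"
  using assms
proof (induction T arbitrary: V)
  case empty
  then have "card V - card R = card (V - R)"
    by (simp add: card_Diff_subset finite_subset)
  then show ?case
    using card_separating_marked[of R V R] empty finite_subset[of R V] by simp
next
  case (insert t T)
  let ?V = "V - {t}" and ?h = "\<lambda>m. fact m * int (m choose card R)"
  have t: "t \<in> V" "t \<notin> R" "t \<notin> R \<union> T" using insert.prems insert.hyps by auto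
  have "card (?V - R) = card (V - R - {t})"
    by (rule arg_cong[where f = card]) auto
  \<comment> \<open>Deleting an unmarked point lowers the unmarked count by one, which is the shift
    of \<open>k\<close> in the second sum.\<close>
  then have c: "card (?V - R) - k = card (V - R) - Suc k" for k
    using t insert.prems(1) by simp
  have "int (card (separating V R (R \<union> T))) =
      (\<Sum>k\<le>card T. (- 1) ^ k * int (card T choose k) * ?h (card (V - R) - k))"
    using insert.prems by (intro insert.IH) auto
  moreover have "int (card (separating ?V R (R \<union> T))) =
      (\<Sum>k\<le>card T. (- 1) ^ k * int (card T choose k) * ?h (card (V - R) - Suc k))"
    unfolding c[symmetric] using insert.prems insert.hyps by (intro insert.IH) auto
  moreover have "int (card (separating V R (R \<union> T))) =
      int (card (separating V R (insert t (R \<union> T)))) + int (card (separating ?V R (R \<union> T)))"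
    using card_separating_split[of V t "R \<union> T" R] t insert.prems(1) by simp
  ultimately show ?case
    using alternating_binomial_Suc[of "card T" "\<lambda>k. ?h (card (V - R) - k)"] insert.hyps by simp
qed

lemma r_derangement_number_eq:
  "int (r_derangement_number r n) =
    (\<Sum>k\<le>n. (- 1) ^ k * int (n choose k) * (fact (n - k) * int (n - k choose r)))"
proof -
  have "r_derangements r n = separating {1..n + r} {1..r} ({1..r} \<union> {Suc r..n + r})"
  proof -
    have "{1..r} \<union> {Suc r..n + r} = {1..n + r}" by auto
    then show ?thesis
      unfolding r_derangements_def separating_def by (simp only: conj_ac)
  qed
  moreover have "{1..n + r} - {1..r} = {Suc r..n + r}" by auto
  moreover have "card {1..r} = r" "card {Suc r..n + r} = n" by simp_all
  moreover have "int (card (separating {1..n + r} {1..r} ({1..r} \<union> {Suc r..n + r}))) =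
      (\<Sum>k\<le>card {Suc r..n + r}. (- 1) ^ k * int (card {Suc r..n + r} choose k) *
        (fact (card ({1..n + r} - {1..r}) - k) * int (card ({1..n + r} - {1..r}) - k choose card {1..r})))"
    by (intro card_separating_unmarked) auto
  ultimately show ?thesis
    unfolding r_derangement_number_def by (simp only:)
qed

section \<open>Polynomial form of \<open>C r n\<close> and its integrality\<close>

lemma fact_eq_prod_fact:
  assumes "k \<le> m"
  shows "(fact m :: int) = (\<Prod>i<k. int m - int i) * fact (m - k)"
  using assms
proof (induction k)
  case (Suc k)
  then have "m - k = Suc (m - Suc k)" by simp
  then have "(fact (m - k) :: int) = (int m - int k) * fact (m - Suc k)"
    using Suc.prems by simp
  then show ?case using Suc by simp
qed simp

text \<open>
  The product is the falling factorial of \<open>x - r\<close> of length \<open>j - r\<close>. It vanishes at \<open>x = n\<close> for \<open>j > n\<close>,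
  so one cutoff \<open>N\<close>, hence one polynomial in \<open>x\<close>, serves all \<open>n \<le> N\<close>.
\<close>

definition signed_C :: "nat \<Rightarrow> nat \<Rightarrow> int \<Rightarrow> int" where
  "signed_C N r x = (\<Sum>j=r..N. (- 1) ^ j * int (j choose r) * (\<Prod>i<j - r. x - int r - int i))"

text \<open>With \<open>j = n - k\<close>, the factor \<open>(n choose j) * j!\<close> is
  \<open>n! / (n - j)!\<close>, and \<open>(n - r)! / (n - j)!\<close> is a falling factorial of
  \<open>n - r\<close>; hence \<open>n!\<close> splits off from every term.\<close>

lemma r_derangement_number_signed_C:
  assumes "r \<le> n"
  shows "fact (n - r) * int (r_derangement_number r n) = (- 1) ^ n * fact n * signed_C n r (int n)"
proof -
  have term_eq: "fact (n - r) * ((- 1) ^ (n - j) * int (n choose (n - j)) * (fact j * int (j choose r))) =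
      (- 1) ^ n * fact n * ((- 1) ^ j * int (j choose r) * (\<Prod>i<j - r. int n - int r - int i))"
    if j: "j \<in> {r..n}" for j
  proof -
    have sgn: "(- 1) ^ (n - j) = (- 1) ^ n * (- 1 :: int) ^ j"
      using j by (auto simp: minus_one_power_iff)
    have "(fact n :: int) = fact j * fact (n - j) * int (n choose j)"
      using binomial_fact_lemma[of j n] j by (metis atLeastAtMost_iff of_nat_fact of_nat_mult)
    moreover have "(fact (n - r) :: int) = (\<Prod>i<j - r. int n - int r - int i) * fact (n - j)"
      using fact_eq_prod_fact[of "j - r" "n - r"] diff_le_mono[of j n r] j assms
      by (simp add: of_nat_diff)
    moreover have "n choose (n - j) = n choose j"
      using j by (simp add: binomial_symmetric[symmetric])
    ultimately show ?thesis
      unfolding sgn by (simp only: mult_ac)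
  qed
  have "int (r_derangement_number r n) =
      (\<Sum>j\<le>n. (- 1) ^ (n - j) * int (n choose (n - j)) * (fact j * int (j choose r)))"
    unfolding r_derangement_number_eq
    by (rule sum.reindex_bij_witness[of _ "\<lambda>j. n - j" "\<lambda>j. n - j"]) auto
  \<comment> \<open>Terms with \<open>j < r\<close> vanish because
    \<open>j choose r = 0\<close>.\<close>
  also have "\<dots> = (\<Sum>j=r..n. (- 1) ^ (n - j) * int (n choose (n - j)) * (fact j * int (j choose r)))"
    by (rule sum.mono_neutral_right) auto
  finally show ?thesis
    by (simp only: signed_C_def sum_distrib_left sum.cong[OF refl term_eq])
qed

text \<open>In particular \<open>C r n\<close> is an integer, so the floors taken below are
  exact.\<close>

lemma C_eq_signed_C:
  assumes "r \<le> n"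
  shows "C r n = of_int ((- 1) ^ n * signed_C n r (int n))"
proof -
  have "of_int (fact (n - r) * int (r_derangement_number r n)) =
      (of_int ((- 1) ^ n * fact n * signed_C n r (int n)) :: rat)"
    unfolding r_derangement_number_signed_C[OF assms] ..
  then show ?thesis
    by (simp add: C_def divide_simps mult_ac)
qed

lemma signed_C_upper:
  assumes "r \<le> n" "n \<le> N"
  shows "signed_C n r (int n) = signed_C N r (int n)"
  unfolding signed_C_def
proof (rule sum.mono_neutral_left)
  show "\<forall>j\<in>{r..N} - {r..n}.
      (- 1) ^ j * int (j choose r) * (\<Prod>i<j - r. int n - int r - int i) = 0"
  proof
    fix j
    assume "j \<in> {r..N} - {r..n}"
    \<comment> \<open>For \<open>j > n\<close> the factor with index \<open>i = n - r\<close>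
      occurs, and it is zero.\<close>
    then have "n - r \<in> {..<j - r}" using assms by auto
    moreover have "int n - int r - int (n - r) = 0" using assms by (simp add: of_nat_diff)
    ultimately show "(- 1) ^ j * int (j choose r) * (\<Prod>i<j - r. int n - int r - int i) = 0"
      by (metis finite_lessThan mult_zero_right prod_zero)
  qed
qed (use assms in auto)

section \<open>Congruences and periodicity\<close>

lemma signed_C_cong:
  assumes "[x = y] (mod m)"
  shows "[signed_C N r x = signed_C N r y] (mod m)"
  unfolding signed_C_def
  by (intro cong_sum cong_mult cong_prod cong_diff cong_refl assms)

lemma floor_C_cong:
  assumes "r \<le> n1" "r \<le> n2" "[n1 = n2] (mod d)"
  shows "[(- 1) ^ n1 * \<lfloor>C r n1\<rfloor> = (- 1) ^ n2 * \<lfloor>C r n2\<rfloor>] (mod int d)"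
proof -
  \<comment> \<open>The cutoff \<open>max n1 n2\<close> makes both sides values of one integer
    polynomial.\<close>
  have signed: "(- 1) ^ n * \<lfloor>C r n\<rfloor> = signed_C (max n1 n2) r (int n)"
    if "r \<le> n" "n \<le> max n1 n2" for n
    by (simp only: C_eq_signed_C[OF that(1)] signed_C_upper[OF that] floor_of_int left_minus_one_mult_self)
  have "[int n1 = int n2] (mod int d)"
    using assms by (simp add: cong_int_iff)
  then show ?thesis
    using assms by (simp only: signed signed_C_cong max.cobounded1 max.cobounded2)
qed

text \<open>An even shift leaves the sign unchanged; this covers \<open>T = d\<close> for even
  \<open>d\<close> and \<open>T = 2 * d\<close> for odd \<open>d\<close>.\<close>

lemma floor_C_periodic:
  assumes "even T" "d dvd T"
  shows "periodic_from r T (\<lambda>n. \<lfloor>C r n\<rfloor> mod int d)"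
  unfolding periodic_from_def
proof (intro allI impI)
  fix n
  assume n: "n \<ge> r"
  have "[n + T = n] (mod d)"
    using assms by (auto simp: cong_def elim!: dvdE)
  then have "[(- 1) ^ n * \<lfloor>C r (n + T)\<rfloor> = (- 1) ^ n * \<lfloor>C r n\<rfloor>] (mod int d)"
    using floor_C_cong[of r "n + T" n d] n assms by (simp add: power_add)
  \<comment> \<open>A second factor \<open>(- 1) ^ n\<close> cancels the sign.\<close>
  then have "[(- 1) ^ n * ((- 1) ^ n * \<lfloor>C r (n + T)\<rfloor>) = (- 1) ^ n * ((- 1) ^ n * \<lfloor>C r n\<rfloor>)] (mod int d)"
    by (rule cong_scalar_left)
  then show "\<lfloor>C r (n + T)\<rfloor> mod int d = \<lfloor>C r n\<rfloor> mod int d"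
    by (simp add: cong_def)
qed

theorem theorem12:
  fixes r d :: nat
  assumes "r \<ge> 1" and "d \<ge> 1"
  shows "(\<forall>n\<ge>r. C r n \<in> \<int>) \<and>
    (\<forall>n1\<ge>r. \<forall>n2\<ge>r. [n1 = n2] (mod d) \<longrightarrow>
       [(- 1) ^ n1 * \<lfloor>C r n1\<rfloor> = (- 1) ^ n2 * \<lfloor>C r n2\<rfloor>] (mod int d)) \<and>
    (even d \<longrightarrow> periodic_from r d (\<lambda>n. \<lfloor>C r n\<rfloor> mod int d)) \<and>
    (odd d \<longrightarrow> periodic_from r (2 * d) (\<lambda>n. \<lfloor>C r n\<rfloor> mod int d))"
proof (intro conjI allI impI)
  show "C r n \<in> \<int>" if "n \<ge> r" for n
    using C_eq_signed_C[OF that] by simp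
qed (use floor_C_cong floor_C_periodic in auto)

end
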